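(* Let $\mathcal{T}$ be a t-norm and let $R$ be a fuzzy $\mathcal{T}$-equivalence on a set $U$, with membership function $\mu_R\colon U^2\to[0,1]$, having a dually well-ordered spectrum. Let $E=\{(x,y)\in U^2\mid \mu_R(x,y)=1\}$, which is a (crisp) equivalence relation on $U$. Then the poset $(\mathcal{RS}(U,R),\leq)$ of fuzzy rough sets with crisp reference sets is a complete lattice isomorphic to the lattice $(\mathrm{RS}(U,E),\leq)$ of rough sets of $E$.
   Context: A t-norm is a commutative, associative mapping $\mathcal{T}\colon[0,1]^2\to[0,1]$, increasing (order-preserving) in each argument, with $\mathcal{T}(1,x)=\mathcal{T}(x,1)=x$ for all $x\in[0,1]$. A fuzzy relation $R$ on $U$ is given by a map $\mu_R\colon U^2\to[0,1]$. It is a fuzzy $\mathcal{T}$-equivalence if $\mu_R(x,x)=1$, $\mu_R(x,y)=\mu_R(y,x)$ and $\mathcal{T}(\mu_R(x,y),\mu_R(y,z))\leq\mu_R(x,z)$ for all $x,y,z\in U$. The spectrum of $R$ is $S_R=\{\mu_R(x,y)\mid x,y\in U\}\subseteq[0,1]$. $R$ has a dually well-ordered spectrum if every nonempty subset of $S_R$ has a maximal element. For a crisp set $A\subseteq U$, define $\mu_{[A]_R},\mu_{[A]^R}\colon U\to[0,1]$ by $\mu_{[A]_R}(x)=\inf\{1-\mu_R(x,y)\mid y\in U,\ y\notin A\}$ and $\mu_{[A]^R}(x)=\sup\{\mu_R(x,y)\mid y\in A\}$, with the conventions $\inf\emptyset=1$, $\sup\emptyset=0$. Put $\mathcal{RS}(U,R)=\{(\mu_{[A]_R},\mu_{[A]^R})\mid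 A\subseteq U\}$, ordered componentwise and pointwise: $(\mu_{[A]_R},\mu_{[A]^R})\leq(\mu_{[B]_R},\mu_{[B]^R})$ iff $\mu_{[A]_R}(x)\leq\mu_{[B]_R}(x)$ and $\mu_{[A]^R}(x)\leq\mu_{[B]^R}(x)$ for all $x\in U$. For a crisp equivalence relation $E$ on $U$ with classes $[x]_E$, and $A\subseteq U$, let $A_E=\{x\in U\mid[x]_E\subseteq A\}$ and $A^E=\{x\in U\mid[x]_E\cap A\neq\emptyset\}$. Put $\mathrm{RS}(U,E)=\{(A_E,A^E)\mid A\subseteq U\}$, ordered by componentwise inclusion; it is known to be a complete lattice. *)

theory Defs
  imports Complex_Main "HOL-Library.FuncSet" "HOL-Algebra.Complete_Lattice"
begin

definition t_norm :: "(real \<Rightarrow> real \<Rightarrow> real) \<Rightarrow> bool" where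
  "t_norm T \<longleftrightarrow>
     (\<forall>x\<in>{0..1}. \<forall>y\<in>{0..1}. T x y \<in> {0..1}) \<and>
     (\<forall>x\<in>{0..1}. \<forall>y\<in>{0..1}. T x y = T y x) \<and>
     (\<forall>x\<in>{0..1}. \<forall>y\<in>{0..1}. \<forall>z\<in>{0..1}. T (T x y) z = T x (T y z)) \<and>
     (\<forall>x\<in>{0..1}. \<forall>x'\<in>{0..1}. \<forall>y\<in>{0..1}. \<forall>y'\<in>{0..1}.
        x \<le> x' \<and> y \<le> y' \<longrightarrow> T x y \<le> T x' y') \<and>
     (\<forall>x\<in>{0..1}. T 1 x = x \<and> T x 1 = x)"

definition fuzzy_relation :: "'a set \<Rightarrow> ('a \<Rightarrow> 'a \<Rightarrow> real) \<Rightarrow> bool" where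
  "fuzzy_relation U \<mu> \<longleftrightarrow> (\<forall>x\<in>U. \<forall>y\<in>U. \<mu> x y \<in> {0..1})"

definition fuzzy_equivalence ::
  "(real \<Rightarrow> real \<Rightarrow> real) \<Rightarrow> 'a set \<Rightarrow> ('a \<Rightarrow> 'a \<Rightarrow> real) \<Rightarrow> bool" where
  "fuzzy_equivalence T U \<mu> \<longleftrightarrow>
     fuzzy_relation U \<mu> \<and>
     (\<forall>x\<in>U. \<mu> x x = 1) \<and>
     (\<forall>x\<in>U. \<forall>y\<in>U. \<mu> x y = \<mu> y x) \<and>
     (\<forall>x\<in>U. \<forall>y\<in>U. \<forall>z\<in>U. T (\<mu> x y) (\<mu> y z) \<le> \<mu> x z)"

definition spectrum :: "'a set \<Rightarrow> ('a \<Rightarrow> 'a \<Rightarrow> real) \<Rightarrow> real set" where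
  "spectrum U \<mu> = {\<mu> x y |x y. x \<in> U \<and> y \<in> U}"

definition dually_well_ordered :: "real set \<Rightarrow> bool" where
  "dually_well_ordered S \<longleftrightarrow>
     (\<forall>X. X \<subseteq> S \<and> X \<noteq> {} \<longrightarrow> (\<exists>m\<in>X. \<forall>x\<in>X. m \<le> x \<longrightarrow> x = m))"

text \<open>Bounds taken in the complete lattice \<open>[0,1]\<close>; the operators on \<^typ>\<open>real\<close> are
  unspecified on the empty set.\<close>

definition unit_Inf :: "real set \<Rightarrow> real" where
  "unit_Inf S = (if S = {} then 1 else Inf S)"

definition unit_Sup :: "real set \<Rightarrow> real" where
  "unit_Sup S = (if S = {} then 0 else Sup S)"

text \<open>Membership functions are maps \<open>U \<rightarrow> [0,1]\<close>, represented extensionally, so that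
  equality of functions coincides with equality on \<open>U\<close>.\<close>

definition fuzzy_lower :: "'a set \<Rightarrow> ('a \<Rightarrow> 'a \<Rightarrow> real) \<Rightarrow> 'a set \<Rightarrow> 'a \<Rightarrow> real" where
  "fuzzy_lower U \<mu> A = (\<lambda>x\<in>U. unit_Inf {1 - \<mu> x y |y. y \<in> U \<and> y \<notin> A})"

definition fuzzy_upper :: "'a set \<Rightarrow> ('a \<Rightarrow> 'a \<Rightarrow> real) \<Rightarrow> 'a set \<Rightarrow> 'a \<Rightarrow> real" where
  "fuzzy_upper U \<mu> A = (\<lambda>x\<in>U. unit_Sup {\<mu> x y |y. y \<in> A})"

definition fuzzy_rough_sets ::
  "'a set \<Rightarrow> ('a \<Rightarrow> 'a \<Rightarrow> real) \<Rightarrow> (('a \<Rightarrow> real) \<times> ('a \<Rightarrow> real)) gorder" where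
  "fuzzy_rough_sets U \<mu> =
     \<lparr>carrier = {(fuzzy_lower U \<mu> A, fuzzy_upper U \<mu> A) |A. A \<subseteq> U},
      eq = (=),
      le = (\<lambda>(l, u) (l', u'). \<forall>x\<in>U. l x \<le> l' x \<and> u x \<le> u' x)\<rparr>"

definition crisp_core :: "'a set \<Rightarrow> ('a \<Rightarrow> 'a \<Rightarrow> real) \<Rightarrow> ('a \<times> 'a) set" where
  "crisp_core U \<mu> = {(x, y). x \<in> U \<and> y \<in> U \<and> \<mu> x y = 1}"

definition rough_lower :: "'a set \<Rightarrow> ('a \<times> 'a) set \<Rightarrow> 'a set \<Rightarrow> 'a set" where
  "rough_lower U E A = {x \<in> U. E `` {x} \<subseteq> A}"

definition rough_upper :: "'a set \<Rightarrow> ('a \<times> 'a) set \<Rightarrow> 'a set \<Rightarrow> 'a set" where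
  "rough_upper U E A = {x \<in> U. E `` {x} \<inter> A \<noteq> {}}"

definition rough_sets :: "'a set \<Rightarrow> ('a \<times> 'a) set \<Rightarrow> ('a set \<times> 'a set) gorder" where
  "rough_sets U E =
     \<lparr>carrier = {(rough_lower U E A, rough_upper U E A) |A. A \<subseteq> U},
      eq = (=),
      le = (\<lambda>(L, H) (L', H'). L \<subseteq> L' \<and> H \<subseteq> H')\<rparr>"

definition order_isomorphic :: "('a, 'c) gorder_scheme \<Rightarrow> ('b, 'd) gorder_scheme \<Rightarrow> bool" where
  "order_isomorphic P Q \<longleftrightarrow>
     (\<exists>f. bij_betw f (carrier P) (carrier Q) \<and> order_emb P Q f)"

end

theory Submission
  imports Defs
begin

text \<open>The dual well-ordering makes every supremum defining the upper approximation a maximum, so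
  the upper approximation of \<open>A\<close> lies below that of \<open>B\<close> iff every element of \<open>A\<close> is \<open>E\<close>-related to
  an element of \<open>B\<close>, i.e. iff the same holds for the crisp upper approximations with respect to
  \<open>E\<close>. Complementation turns this into the corresponding statement about lower approximations.
  Hence both posets are quotients of the power set of \<open>U\<close> by the same preorder. That the crisp one
  is complete follows since the pairs \<open>(L, H)\<close> that are rough sets are precisely the nested pairs
  of unions of classes such that \<open>H - L\<close> contains no one-element class, a condition
  stable under componentwise unions and intersections.\<close>

section \<open>Order isomorphisms\<close>

text \<open>Both orders pull back along \<open>p\<close> and \<open>q\<close> to the same preorder
  on \<open>S\<close>. By antisymmetry each poset is the quotient of that preorder, so sending
  \<open>p A\<close> to \<open>q A\<close> is well defined, injective and order preserving in both
  directions.\<close>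

lemma order_isomorphic_parametrized:
  assumes "partial_order P" and "partial_order Q"
    and carrP: "carrier P = p ` S" and carrQ: "carrier Q = q ` S"
    and le_iff: "\<And>A B. A \<in> S \<Longrightarrow> B \<in> S \<Longrightarrow> p A \<sqsubseteq>\<^bsub>P\<^esub> p B \<longleftrightarrow> q A \<sqsubseteq>\<^bsub>Q\<^esub> q B"
  shows "order_isomorphic P Q"
proof -
  interpret P: partial_order P by fact
  interpret Q: partial_order Q by fact
  have eq_iff: "p A = p B \<longleftrightarrow> q A = q B" if "A \<in> S" "B \<in> S" for A B
    using that le_iff P.le_antisym Q.le_antisym carrP carrQ P.le_refl Q.le_refl
    by (metis imageI)
  \<comment> \<open>\<open>inv_into S p\<close> picks an arbitrary parameter of \<open>u\<close>; by
    \<open>eq_iff\<close> the value of \<open>q\<close> does not depend on the choice.\<close>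
  define f where "f = (\<lambda>u. q (inv_into S p u))"
  have f: "f (p A) = q A" if "A \<in> S" for A
    using that eq_iff unfolding f_def
    by (metis f_inv_into_f imageI inv_into_into)
  have "inj_on f (carrier P)"
    unfolding carrP by (rule inj_onI) (auto simp: f eq_iff)
  moreover have "f ` carrier P = carrier Q"
    unfolding carrP carrQ image_image by (rule image_cong) (auto simp: f)
  moreover have "order_emb P Q f"
    unfolding order_emb_def
    by (auto simp: carrP f le_iff P.weak_partial_order_axioms Q.weak_partial_order_axioms)
  ultimately show ?thesis
    unfolding order_isomorphic_def bij_betw_def by blast
qed

text \<open>Completeness is pulled back along \<open>f\<close>: a supremum or infimum of the image
  of \<open>X\<close> exists in \<open>Q\<close>, has a preimage by surjectivity, and that preimage
  is the required bound because \<open>f\<close> preserves and reflects the order.\<close>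

lemma complete_lattice_order_isomorphic:
  assumes "partial_order P" and "complete_lattice Q" and "order_isomorphic P Q"
  shows "complete_lattice P"
proof -
  interpret P: partial_order P by fact
  interpret Q: complete_lattice Q by fact
  obtain f where bij: "bij_betw f (carrier P) (carrier Q)" and emb: "order_emb P Q f"
    using assms(3) unfolding order_isomorphic_def by blast
  have le: "f x \<sqsubseteq>\<^bsub>Q\<^esub> f y \<longleftrightarrow> x \<sqsubseteq>\<^bsub>P\<^esub> y" if "x \<in> carrier P" "y \<in> carrier P" for x y
    using that emb by (auto simp: order_emb_def)
  have fim: "f ` carrier P = carrier Q"
    using bij by (simp add: bij_betw_def)
  show ?thesis
  proof (rule P.complete_latticeI)
    fix X assume X: "X \<subseteq> carrier P"
    have fX: "f ` X \<subseteq> carrier Q" using X fim by blast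
    obtain s' where s': "least Q s' (Upper Q (f ` X))"
      using Q.sup_exists[OF fX] by blast
    then have "s' \<in> carrier Q" by (auto simp: least_def Upper_def)
    then obtain s where s: "s \<in> carrier P" "s' = f s" using fim by blast
    have "least P s (Upper P X)"
    proof (rule least_UpperI)
      show "x \<sqsubseteq>\<^bsub>P\<^esub> s" if "x \<in> X" for x
      proof -
        have "f x \<in> f ` X \<inter> carrier Q" using that fX by blast
        then have "f x \<sqsubseteq>\<^bsub>Q\<^esub> f s" using s' s(2) unfolding least_def Upper_def by blast
        then show ?thesis using le that X s(1) by blast
      qed
      show "s \<sqsubseteq>\<^bsub>P\<^esub> y" if y: "y \<in> Upper P X" for y
      proof -
        have "y \<in> carrier P" and "\<forall>x\<in>X. x \<sqsubseteq>\<^bsub>P\<^esub> y" using y X by (auto simp: Upper_def)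
        then have "f y \<in> Upper Q (f ` X)"
          using X fim le by (auto simp: Upper_def)
        then show ?thesis
          using s' s le[of s y] \<open>y \<in> carrier P\<close> by (auto simp: least_def)
      qed
    qed (use X s in auto)
    then show "\<exists>s. least P s (Upper P X)" ..
    obtain i' where i': "greatest Q i' (Lower Q (f ` X))"
      using Q.inf_exists[OF fX] by blast
    then have "i' \<in> carrier Q" by (auto simp: greatest_def Lower_def)
    then obtain i where i: "i \<in> carrier P" "i' = f i" using fim by blast
    have "greatest P i (Lower P X)"
    proof (rule greatest_LowerI)
      show "i \<sqsubseteq>\<^bsub>P\<^esub> x" if "x \<in> X" for x
      proof -
        have "f x \<in> f ` X \<inter> carrier Q" using that fX by blast
        then have "f i \<sqsubseteq>\<^bsub>Q\<^esub> f x" using i' i(2) unfolding greatest_def Lower_def by blast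
        then show ?thesis using le that X i(1) by blast
      qed
      show "y \<sqsubseteq>\<^bsub>P\<^esub> i" if y: "y \<in> Lower P X" for y
      proof -
        have "y \<in> carrier P" and "\<forall>x\<in>X. y \<sqsubseteq>\<^bsub>P\<^esub> x" using y X by (auto simp: Lower_def)
        then have "f y \<in> Lower Q (f ` X)"
          using X fim le by (auto simp: Lower_def)
        then show ?thesis
          using i' i le[of y i] \<open>y \<in> carrier P\<close> by (auto simp: greatest_def)
      qed
    qed (use X i in auto)
    then show "\<exists>i. greatest P i (Lower P X)" ..
  qed
qed

section \<open>Rough sets of an equivalence relation\<close>

lemma partial_order_rough_sets: "partial_order (rough_sets U E)"
  by unfold_locales (auto simp: rough_sets_def)

lemma carrier_rough_sets:
  "carrier (rough_sets U E) = (\<lambda>A. (rough_lower U E A, rough_upper U E A)) ` Pow U"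
  by (auto simp: rough_sets_def)

text \<open>This trades the existential over \<open>A\<close> for conditions on
  \<open>(L, H)\<close> alone. A one-element class meeting \<open>A\<close> is contained in
  \<open>A\<close>, which forces the last condition. Conversely, a larger class can meet
  \<open>A\<close> without being contained in it, so one representative per class of
  \<open>H\<close>, added to \<open>L\<close>, gives a suitable \<open>A\<close>.\<close>

lemma rough_set_iff:
  assumes E: "equiv U E"
  shows "(L, H) \<in> carrier (rough_sets U E) \<longleftrightarrow>
    L \<subseteq> H \<and> H \<subseteq> U \<and> E `` L \<subseteq> L \<and> E `` H \<subseteq> H \<and> (\<forall>x\<in>H. E `` {x} = {x} \<longrightarrow> x \<in> L)"
    (is "_ \<longleftrightarrow> ?R")
proof
  have refl: "(x, x) \<in> E" if "x \<in> U" for x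
    using E that by (auto simp: equiv_def refl_on_def)
  have sub: "x \<in> U \<and> y \<in> U" if "(x, y) \<in> E" for x y
    using E that equiv_type by blast
  have sym: "(y, x) \<in> E" if "(x, y) \<in> E" for x y
    using E that by (auto simp: equiv_def sym_def)
  have trans: "(x, z) \<in> E" if "(x, y) \<in> E" "(y, z) \<in> E" for x y z
    using E that by (meson equiv_def transD)
  {
    assume "(L, H) \<in> carrier (rough_sets U E)"
    then obtain A where "A \<subseteq> U" and L: "L = {x \<in> U. E `` {x} \<subseteq> A}"
      and H: "H = {x \<in> U. E `` {x} \<inter> A \<noteq> {}}"
      by (auto simp: rough_sets_def rough_lower_def rough_upper_def)
    show ?R
      unfolding L H
    proof (intro conjI ballI impI)
      show "E `` {x \<in> U. E `` {x} \<subseteq> A} \<subseteq> {x \<in> U. E `` {x} \<subseteq> A}"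
        using sub trans by blast
      show "E `` {x \<in> U. E `` {x} \<inter> A \<noteq> {}} \<subseteq> {x \<in> U. E `` {x} \<inter> A \<noteq> {}}"
        using sub trans sym by blast
    qed (use refl in auto)
  next
    assume ?R
    then have "L \<subseteq> H" "H \<subseteq> U" and sing: "\<And>x. x \<in> H \<Longrightarrow> E `` {x} = {x} \<Longrightarrow> x \<in> L"
      and Lcl: "\<And>x y. x \<in> L \<Longrightarrow> (x, y) \<in> E \<Longrightarrow> y \<in> L"
      and Hcl: "\<And>x y. x \<in> H \<Longrightarrow> (x, y) \<in> E \<Longrightarrow> y \<in> H"
      by blast+
    \<comment> \<open>A choice of one representative per class; \<open>r_eq\<close> holds because
      related elements hand the same predicate to \<open>SOME\<close>.\<close>
    define r where "r x = (SOME y. (x, y) \<in> E)" for x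
    have r: "(x, r x) \<in> E" if "x \<in> U" for x
      unfolding r_def using refl[OF that] by (rule someI)
    have r_eq: "r x = r y" if "(x, y) \<in> E" for x y
    proof -
      have "(\<lambda>z. (x, z) \<in> E) = (\<lambda>z. (y, z) \<in> E)"
        using that sym trans by blast
      then show ?thesis by (simp add: r_def)
    qed
    define A where "A = L \<union> r ` H"
    have "A \<subseteq> H"
      using \<open>L \<subseteq> H\<close> \<open>H \<subseteq> U\<close> Hcl r unfolding A_def by blast
    then have "A \<subseteq> U"
      using \<open>H \<subseteq> U\<close> by blast
    moreover have "rough_upper U E A = H"
    proof (intro equalityI subsetI)
      fix x assume "x \<in> rough_upper U E A"
      then obtain y where y: "(x, y) \<in> E" "y \<in> A"
        by (auto simp: rough_upper_def)
      then show "x \<in> H" using \<open>A \<subseteq> H\<close> Hcl sym by blast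
    next
      fix x assume "x \<in> H"
      moreover from this have "x \<in> U" using \<open>H \<subseteq> U\<close> by blast
      ultimately show "x \<in> rough_upper U E A"
        using r[of x] unfolding A_def rough_upper_def by blast
    qed
    moreover have "rough_lower U E A = L"
    proof (intro equalityI subsetI)
      fix x assume "x \<in> rough_lower U E A"
      then have x: "x \<in> U" "E `` {x} \<subseteq> A" by (auto simp: rough_lower_def)
      show "x \<in> L"
      proof (rule ccontr)
        assume "x \<notin> L"
        \<comment> \<open>Outside \<open>L\<close> the set \<open>A\<close> contains only
          representatives, so a class inside \<open>A\<close> but not in \<open>L\<close> is reduced
          to its representative; \<open>sing\<close> then puts it in \<open>L\<close>, a
          contradiction.\<close>
        have rep: "z = r x" if z: "(x, z) \<in> E" for z
        proof -
          have "z \<notin> L" using \<open>x \<notin> L\<close> Lcl sym[OF z] by blast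
          then obtain h where h: "h \<in> H" "z = r h" using x z unfolding A_def by blast
          then have "(h, z) \<in> E" using r \<open>H \<subseteq> U\<close> by blast
          then have "(x, h) \<in> E" using trans[OF z sym] by blast
          then show ?thesis using r_eq h(2) by simp
        qed
        have "z = x" if "(x, z) \<in> E" for z
          using rep[OF that] rep[OF refl[OF x(1)]] by simp
        then have "E `` {x} = {x}" using refl[OF x(1)] by blast
        moreover have "x \<in> H"
          using refl[OF x(1)] x(2) \<open>A \<subseteq> H\<close> by blast
        ultimately show False using sing \<open>x \<notin> L\<close> by blast
      qed
    next
      fix x assume "x \<in> L"
      then show "x \<in> rough_lower U E A"
        using \<open>L \<subseteq> H\<close> \<open>H \<subseteq> U\<close> Lcl unfolding A_def rough_lower_def by blast
    qed
    ultimately show "(L, H) \<in> carrier (rough_sets U E)"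
      unfolding carrier_rough_sets by blast
  }
qed

text \<open>Joins and meets are componentwise unions and intersections; the point is that these
  pairs again satisfy the conditions of \<open>rough_set_iff\<close>.\<close>

lemma complete_lattice_rough_sets:
  assumes E: "equiv U E"
  shows "complete_lattice (rough_sets U E)"
proof -
  let ?P = "rough_sets U E"
  have le: "p \<sqsubseteq>\<^bsub>?P\<^esub> q \<longleftrightarrow> fst p \<subseteq> fst q \<and> snd p \<subseteq> snd q" for p q
    by (auto simp: rough_sets_def split: prod.splits)
  have iff: "p \<in> carrier ?P \<longleftrightarrow> fst p \<subseteq> snd p \<and> snd p \<subseteq> U \<and> E `` fst p \<subseteq> fst p \<and>
      E `` snd p \<subseteq> snd p \<and> (\<forall>x\<in>snd p. E `` {x} = {x} \<longrightarrow> x \<in> fst p)" for p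
    using rough_set_iff[OF E, of "fst p" "snd p"] by simp
  show ?thesis
  proof (rule partial_order.complete_latticeI[OF partial_order_rough_sets])
    fix X assume X: "X \<subseteq> carrier ?P"
    have mem: "fst p \<subseteq> snd p" "snd p \<subseteq> U" "E `` fst p \<subseteq> fst p" "E `` snd p \<subseteq> snd p"
      "\<forall>x\<in>snd p. E `` {x} = {x} \<longrightarrow> x \<in> fst p" if "p \<in> X" for p
      using iff[THEN iffD1, OF subsetD[OF X that]] by blast+
    have "(\<Union>p\<in>X. fst p, \<Union>p\<in>X. snd p) \<in> carrier ?P"
      unfolding rough_set_iff[OF E]
    proof (intro conjI)
      show "\<forall>x\<in>\<Union>p\<in>X. snd p. E `` {x} = {x} \<longrightarrow> x \<in> (\<Union>p\<in>X. fst p)"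
        using mem(5) by blast
      show "(\<Union>p\<in>X. fst p) \<subseteq> (\<Union>p\<in>X. snd p)"
        using mem(1) by blast
      show "(\<Union>p\<in>X. snd p) \<subseteq> U"
        using mem(2) by blast
      show "E `` (\<Union>p\<in>X. fst p) \<subseteq> (\<Union>p\<in>X. fst p)"
        using mem(3) by blast
      show "E `` (\<Union>p\<in>X. snd p) \<subseteq> (\<Union>p\<in>X. snd p)"
        using mem(4) by blast
    qed
    then have "least ?P (\<Union>p\<in>X. fst p, \<Union>p\<in>X. snd p) (Upper ?P X)"
    proof (rule least_UpperI[rotated 3])
      fix q assume "q \<in> Upper ?P X"
      then have "fst p \<subseteq> fst q \<and> snd p \<subseteq> snd q" if "p \<in> X" for p
        using X that unfolding Upper_def le by blast
      then show "(\<Union>p\<in>X. fst p, \<Union>p\<in>X. snd p) \<sqsubseteq>\<^bsub>?P\<^esub> q"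
        unfolding le by fastforce
    qed (use X in \<open>auto simp: le\<close>)
    then show "\<exists>s. least ?P s (Upper ?P X)" ..
    have EU: "E `` U \<subseteq> U"
      using equiv_type[OF E] by blast
    \<comment> \<open>Intersecting with \<open>U\<close> matters for empty \<open>X\<close>, where
      the bare intersection would be the whole type; the meet is then the top element
      \<open>(U, U)\<close>.\<close>
    have "(U \<inter> (\<Inter>p\<in>X. fst p), U \<inter> (\<Inter>p\<in>X. snd p)) \<in> carrier ?P"
      unfolding rough_set_iff[OF E]
    proof (intro conjI)
      show "\<forall>x\<in>U \<inter> (\<Inter>p\<in>X. snd p). E `` {x} = {x} \<longrightarrow> x \<in> U \<inter> (\<Inter>p\<in>X. fst p)"
        using mem(5) by blast
      show "U \<inter> (\<Inter>p\<in>X. fst p) \<subseteq> U \<inter> (\<Inter>p\<in>X. snd p)"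
        using mem(1) by blast
      show "U \<inter> (\<Inter>p\<in>X. snd p) \<subseteq> U"
        by blast
      show "E `` (U \<inter> (\<Inter>p\<in>X. fst p)) \<subseteq> U \<inter> (\<Inter>p\<in>X. fst p)"
        using mem(3) EU by blast
      show "E `` (U \<inter> (\<Inter>p\<in>X. snd p)) \<subseteq> U \<inter> (\<Inter>p\<in>X. snd p)"
        using mem(4) EU by blast
    qed
    then have "greatest ?P (U \<inter> (\<Inter>p\<in>X. fst p), U \<inter> (\<Inter>p\<in>X. snd p)) (Lower ?P X)"
    proof (rule greatest_LowerI[rotated 3])
      fix q assume q: "q \<in> Lower ?P X"
      then have "fst q \<subseteq> fst p \<and> snd q \<subseteq> snd p" if "p \<in> X" for p
        using X that unfolding Lower_def le by blast
      moreover have "q \<in> carrier ?P"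
        using q by (simp add: Lower_def)
      then have "fst q \<subseteq> U \<and> snd q \<subseteq> U"
        unfolding iff by blast
      ultimately show "q \<sqsubseteq>\<^bsub>?P\<^esub> (U \<inter> (\<Inter>p\<in>X. fst p), U \<inter> (\<Inter>p\<in>X. snd p))"
        unfolding le by fastforce
    qed (use X in \<open>auto simp: le\<close>)
    then show "\<exists>i. greatest ?P i (Lower ?P X)" ..
  qed
qed

text \<open>A class lies in \<open>A\<close> iff it misses the complement of \<open>A\<close>; as
  classes stay inside \<open>U\<close>, the complement relative to \<open>U\<close> is the right
  one.\<close>

lemma rough_lower_eq_compl_upper: "rough_lower U E A = U - rough_upper U E (U - A)"
  if "E \<subseteq> U \<times> U"
  using that by (auto simp: rough_lower_def rough_upper_def)

text \<open>Reflexivity places each \<open>a\<close> in the upper approximation of \<open>A\<close>,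
  which gives one direction; transitivity gives the other. The right-hand side is the preorder on
  subsets that the fuzzy side also induces.\<close>

lemma rough_upper_mono_iff:
  assumes E: "equiv U E" and "A \<subseteq> U"
  shows "rough_upper U E A \<subseteq> rough_upper U E B \<longleftrightarrow> (\<forall>a\<in>A. \<exists>b\<in>B. (a, b) \<in> E)"
proof -
  have "(x, x) \<in> E" if "x \<in> U" for x
    using E that by (auto simp: equiv_def refl_on_def)
  moreover have "(x, z) \<in> E" if "(x, y) \<in> E" "(y, z) \<in> E" for x y z
    using E that by (meson equiv_def transD)
  ultimately show ?thesis
    using \<open>A \<subseteq> U\<close> unfolding rough_upper_def by blast
qed

section \<open>Fuzzy rough sets\<close>

text \<open>Antisymmetry is the delicate axiom: the order compares values on \<open>U\<close> only,
  and extensionality fixes the functions elsewhere.\<close>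

lemma partial_order_fuzzy_rough_sets: "partial_order (fuzzy_rough_sets U \<mu>)"
proof -
  have eq: "fuzzy_lower U \<mu> A = fuzzy_lower U \<mu> B \<and> fuzzy_upper U \<mu> A = fuzzy_upper U \<mu> B"
    if "\<forall>x\<in>U. fuzzy_lower U \<mu> A x \<le> fuzzy_lower U \<mu> B x \<and> fuzzy_upper U \<mu> A x \<le> fuzzy_upper U \<mu> B x"
      "\<forall>x\<in>U. fuzzy_lower U \<mu> B x \<le> fuzzy_lower U \<mu> A x \<and> fuzzy_upper U \<mu> B x \<le> fuzzy_upper U \<mu> A x"
    for A B
  proof
    have ext: "fuzzy_lower U \<mu> C \<in> extensional U" "fuzzy_upper U \<mu> C \<in> extensional U" for C
      by (simp_all add: fuzzy_lower_def fuzzy_upper_def)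
    show "fuzzy_lower U \<mu> A = fuzzy_lower U \<mu> B" "fuzzy_upper U \<mu> A = fuzzy_upper U \<mu> B"
      by (rule extensionalityI[OF ext(1) ext(1)] extensionalityI[OF ext(2) ext(2)];
          use that in \<open>blast intro: order.antisym\<close>)+
  qed
  show ?thesis
    by unfold_locales (use eq in \<open>auto simp: fuzzy_rough_sets_def intro: order_trans\<close>)
qed

lemma carrier_fuzzy_rough_sets:
  "carrier (fuzzy_rough_sets U \<mu>) = (\<lambda>A. (fuzzy_lower U \<mu> A, fuzzy_upper U \<mu> A)) ` Pow U"
  by (auto simp: fuzzy_rough_sets_def)

section \<open>Attained suprema and the duality of the fuzzy approximations\<close>

lemma dually_well_ordered_has_greatest:
  assumes "dually_well_ordered S" "X \<subseteq> S" "X \<noteq> {}"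
  shows "\<exists>m\<in>X. \<forall>x\<in>X. x \<le> m"
  using assms unfolding dually_well_ordered_def by (metis linorder_le_cases order_refl)

text \<open>The values \<open>\<mu> x y\<close> with \<open>y\<close> in \<open>A\<close> form a
  nonempty part of the spectrum, so they have a greatest element, and it is their supremum. For
  empty \<open>A\<close> the default 0 has no witness.\<close>

lemma fuzzy_upper_attained:
  assumes "dually_well_ordered (spectrum U \<mu>)" "A \<subseteq> U" "x \<in> U" "A \<noteq> {}"
  obtains a where "a \<in> A" "fuzzy_upper U \<mu> A x = \<mu> x a" "\<And>y. y \<in> A \<Longrightarrow> \<mu> x y \<le> \<mu> x a"
proof -
  let ?X = "{\<mu> x y |y. y \<in> A}"
  have X: "?X \<subseteq> spectrum U \<mu>" "?X \<noteq> {}"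
    using assms by (auto simp: spectrum_def)
  obtain m where m: "m \<in> ?X" "\<And>v. v \<in> ?X \<Longrightarrow> v \<le> m"
    using dually_well_ordered_has_greatest[OF assms(1) X] by blast
  then obtain a where "a \<in> A" "m = \<mu> x a" by blast
  moreover have "Sup ?X = m"
    using m by (rule cSup_eq_maximum)
  then have "fuzzy_upper U \<mu> A x = m"
    using \<open>?X \<noteq> {}\<close> \<open>x \<in> U\<close> unfolding fuzzy_upper_def unit_Sup_def by (simp only: restrict_apply' if_False)
  ultimately show ?thesis
    using m(2) by (intro that[of a]) auto
qed

lemma fuzzy_upper_empty: "x \<in> U \<Longrightarrow> fuzzy_upper U \<mu> {} x = 0"
  by (simp add: fuzzy_upper_def unit_Sup_def)

lemma fuzzy_lower_eq_compl_upper: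
  assumes "dually_well_ordered (spectrum U \<mu>)" "x \<in> U"
  shows "fuzzy_lower U \<mu> A x = 1 - fuzzy_upper U \<mu> (U - A) x"
proof (cases "U - A = {}")
  \<comment> \<open>Here the two conventions match: infimum 1 on the left, supremum 0 on the
    right.\<close>
  case True
  then have "{1 - \<mu> x y |y. y \<in> U \<and> y \<notin> A} = {}" by blast
  then show ?thesis
    unfolding True fuzzy_upper_empty[OF \<open>x \<in> U\<close>]
    using \<open>x \<in> U\<close> by (simp add: fuzzy_lower_def unit_Inf_def)
next
  case False
  let ?X = "{1 - \<mu> x y |y. y \<in> U \<and> y \<notin> A}"
  obtain a where a: "a \<in> U - A" "fuzzy_upper U \<mu> (U - A) x = \<mu> x a"
      "\<And>y. y \<in> U - A \<Longrightarrow> \<mu> x y \<le> \<mu> x a"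
    using fuzzy_upper_attained[OF assms(1) Diff_subset assms(2) False] by blast
  have "Inf ?X = 1 - \<mu> x a"
    using a by (intro cInf_eq_minimum) auto
  moreover have "?X \<noteq> {}" using False by blast
  ultimately have "fuzzy_lower U \<mu> A x = 1 - \<mu> x a"
    using \<open>x \<in> U\<close> unfolding fuzzy_lower_def unit_Inf_def by (simp only: restrict_apply' if_False)
  then show ?thesis by (simp add: a)
qed

section \<open>The crisp core and the order of fuzzy upper approximations\<close>

text \<open>Since 1 is neutral for \<open>T\<close>, fuzzy transitivity through \<open>y\<close>
  loses nothing when \<open>\<mu> y z = 1\<close>.\<close>

lemma fuzzy_equivalence_absorb:
  assumes "t_norm T" "fuzzy_equivalence T U \<mu>" "x \<in> U" "y \<in> U" "z \<in> U" "\<mu> y z = 1"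
  shows "\<mu> x y \<le> \<mu> x z"
proof -
  have "\<mu> x y \<in> {0..1}"
    using assms unfolding fuzzy_equivalence_def fuzzy_relation_def by blast
  then have "T (\<mu> x y) 1 = \<mu> x y"
    using assms(1) unfolding t_norm_def by blast
  moreover have "T (\<mu> x y) (\<mu> y z) \<le> \<mu> x z"
    using assms unfolding fuzzy_equivalence_def by blast
  ultimately show ?thesis using assms(6) by simp
qed

lemma equiv_crisp_core:
  assumes "t_norm T" and R: "fuzzy_equivalence T U \<mu>"
  shows "equiv U (crisp_core U \<mu>)"
proof (rule equivI)
  show "refl_on U (crisp_core U \<mu>)" "sym (crisp_core U \<mu>)" "crisp_core U \<mu> \<subseteq> U \<times> U"
    using R by (auto simp: crisp_core_def refl_on_def sym_def fuzzy_equivalence_def)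
  show "trans (crisp_core U \<mu>)"
  proof (rule transI)
    fix x y z
    assume "(x, y) \<in> crisp_core U \<mu>" "(y, z) \<in> crisp_core U \<mu>"
    then have xyz: "x \<in> U" "y \<in> U" "z \<in> U" "\<mu> x y = 1" "\<mu> y z = 1"
      by (auto simp: crisp_core_def)
    then have "1 \<le> \<mu> x z"
      using fuzzy_equivalence_absorb[OF assms xyz(1-3,5)] by simp
    moreover have "\<mu> x z \<le> 1"
      using R xyz unfolding fuzzy_equivalence_def fuzzy_relation_def by auto
    ultimately show "(x, z) \<in> crisp_core U \<mu>"
      using xyz by (simp add: crisp_core_def)
  qed
qed

text \<open>Evaluating at a point \<open>a\<close> of \<open>A\<close> gives the value 1 for
  \<open>A\<close>, hence for \<open>B\<close>; as the supremum for \<open>B\<close> is attained,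
  some \<open>b\<close> has \<open>\<mu> a b = 1\<close>. Conversely, a maximiser \<open>a\<close>
  in \<open>A\<close> can be replaced by a core-related \<open>b\<close> in \<open>B\<close> without
  lowering the value.\<close>

lemma fuzzy_upper_mono_iff:
  assumes T: "t_norm T" and R: "fuzzy_equivalence T U \<mu>"
    and dwo: "dually_well_ordered (spectrum U \<mu>)" and A: "A \<subseteq> U" and B: "B \<subseteq> U"
  shows "(\<forall>x\<in>U. fuzzy_upper U \<mu> A x \<le> fuzzy_upper U \<mu> B x) \<longleftrightarrow>
    (\<forall>a\<in>A. \<exists>b\<in>B. (a, b) \<in> crisp_core U \<mu>)"
proof (intro iffI ballI)
  have refl: "\<mu> x x = 1" if "x \<in> U" for x
    using R that by (auto simp: fuzzy_equivalence_def)
  have range: "0 \<le> \<mu> x y \<and> \<mu> x y \<le> 1" if "x \<in> U" "y \<in> U" for x y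
    using R that by (auto simp: fuzzy_equivalence_def fuzzy_relation_def)
  {
    fix a
    assume le: "\<forall>x\<in>U. fuzzy_upper U \<mu> A x \<le> fuzzy_upper U \<mu> B x" and "a \<in> A"
    then have "a \<in> U" using A by blast
    obtain a' where a': "fuzzy_upper U \<mu> A a = \<mu> a a'" "\<And>y. y \<in> A \<Longrightarrow> \<mu> a y \<le> \<mu> a a'"
      using fuzzy_upper_attained[OF dwo A \<open>a \<in> U\<close>] \<open>a \<in> A\<close> by blast
    have "1 \<le> fuzzy_upper U \<mu> A a"
      using a'(1) a'(2)[OF \<open>a \<in> A\<close>] refl[OF \<open>a \<in> U\<close>] by simp
    also have "\<dots> \<le> fuzzy_upper U \<mu> B a"
      using le \<open>a \<in> U\<close> by blast
    finally have ge: "1 \<le> fuzzy_upper U \<mu> B a" .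
    \<comment> \<open>An empty \<open>B\<close> would give the default value 0, which is below
      1.\<close>
    then have "B \<noteq> {}" using fuzzy_upper_empty[OF \<open>a \<in> U\<close>] by force
    then obtain b where b: "b \<in> B" "fuzzy_upper U \<mu> B a = \<mu> a b"
      using fuzzy_upper_attained[OF dwo B \<open>a \<in> U\<close>] by blast
    then have "(a, b) \<in> crisp_core U \<mu>"
      using ge range[of a b] B \<open>a \<in> U\<close> by (auto simp: crisp_core_def)
    then show "\<exists>b\<in>B. (a, b) \<in> crisp_core U \<mu>" using b by blast
  next
    fix x
    assume cov: "\<forall>a\<in>A. \<exists>b\<in>B. (a, b) \<in> crisp_core U \<mu>" and x: "x \<in> U"
    \<comment> \<open>This settles the case of empty \<open>A\<close>, whose upper approximation is
      0 on \<open>U\<close>.\<close>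
    have nonneg: "0 \<le> fuzzy_upper U \<mu> B x"
    proof (cases "B = {}")
      case False
      then obtain b where "b \<in> B" "fuzzy_upper U \<mu> B x = \<mu> x b"
        using fuzzy_upper_attained[OF dwo B x] by blast
      then show ?thesis using range[OF x, of b] B by auto
    qed (simp add: fuzzy_upper_empty x)
    show "fuzzy_upper U \<mu> A x \<le> fuzzy_upper U \<mu> B x"
    proof (cases "A = {}")
      case True
      then show ?thesis using nonneg by (simp add: fuzzy_upper_empty x)
    next
      case False
      then obtain a where a: "a \<in> A" "fuzzy_upper U \<mu> A x = \<mu> x a"
        using fuzzy_upper_attained[OF dwo A x] by blast
      obtain b where b: "b \<in> B" "(a, b) \<in> crisp_core U \<mu>" using cov a by blast
      obtain b' where b': "fuzzy_upper U \<mu> B x = \<mu> x b'" "\<And>y. y \<in> B \<Longrightarrow> \<mu> x y \<le> \<mu> x b'"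
        using fuzzy_upper_attained[OF dwo B x] b by blast
      have "\<mu> x a \<le> \<mu> x b"
        using b x fuzzy_equivalence_absorb[OF T R] by (auto simp: crisp_core_def)
      also have "\<dots> \<le> \<mu> x b'" using b b' by blast
      finally show ?thesis by (simp add: a b')
    qed
  }
qed

theorem theorem1:
  fixes U :: "'a set"
    and \<mu> :: "'a \<Rightarrow> 'a \<Rightarrow> real"
    and T :: "real \<Rightarrow> real \<Rightarrow> real"
  assumes "t_norm T"
    and "fuzzy_equivalence T U \<mu>"
    and "dually_well_ordered (spectrum U \<mu>)"
  shows "equiv U (crisp_core U \<mu>)
    \<and> complete_lattice (fuzzy_rough_sets U \<mu>)
    \<and> order_isomorphic (fuzzy_rough_sets U \<mu>) (rough_sets U (crisp_core U \<mu>))"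
proof -
  let ?E = "crisp_core U \<mu>"
  have E: "equiv U ?E"
    using assms(1,2) by (rule equiv_crisp_core)
  have upper: "(\<forall>x\<in>U. fuzzy_upper U \<mu> A x \<le> fuzzy_upper U \<mu> B x) \<longleftrightarrow>
      rough_upper U ?E A \<subseteq> rough_upper U ?E B" if "A \<subseteq> U" "B \<subseteq> U" for A B
    using fuzzy_upper_mono_iff[OF assms that] rough_upper_mono_iff[OF E that(1)] by simp
  have lower: "(\<forall>x\<in>U. fuzzy_lower U \<mu> A x \<le> fuzzy_lower U \<mu> B x) \<longleftrightarrow>
      rough_lower U ?E A \<subseteq> rough_lower U ?E B" for A B
  proof -
    \<comment> \<open>Complementing in \<open>U\<close> swaps the roles of \<open>A\<close> and
      \<open>B\<close>, and reduces the claim to \<open>upper\<close> for \<open>U - B\<close> and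
      \<open>U - A\<close>.\<close>
    have "(\<forall>x\<in>U. fuzzy_lower U \<mu> A x \<le> fuzzy_lower U \<mu> B x) \<longleftrightarrow>
        (\<forall>x\<in>U. fuzzy_upper U \<mu> (U - B) x \<le> fuzzy_upper U \<mu> (U - A) x)"
      by (simp add: fuzzy_lower_eq_compl_upper[OF assms(3)])
    also have "\<dots> \<longleftrightarrow> rough_upper U ?E (U - B) \<subseteq> rough_upper U ?E (U - A)"
      by (rule upper) auto
    also have "\<dots> \<longleftrightarrow> rough_lower U ?E A \<subseteq> rough_lower U ?E B"
      \<comment> \<open>Both upper approximations lie in \<open>U\<close>, so complementation in
        \<open>U\<close> reverses their inclusion in both directions.\<close>
      unfolding rough_lower_eq_compl_upper[OF equiv_type[OF E]]
      by (auto simp: rough_upper_def)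
    finally show ?thesis .
  qed
  have iso: "order_isomorphic (fuzzy_rough_sets U \<mu>) (rough_sets U ?E)"
  \<comment> \<open>Both carriers are parametrized by \<open>Pow U\<close>, so comparing the two
    orders on reference sets suffices.\<close>
  proof (rule order_isomorphic_parametrized[OF partial_order_fuzzy_rough_sets
        partial_order_rough_sets carrier_fuzzy_rough_sets carrier_rough_sets])
    fix A B assume "A \<in> Pow U" "B \<in> Pow U"
    then show "(fuzzy_lower U \<mu> A, fuzzy_upper U \<mu> A) \<sqsubseteq>\<^bsub>fuzzy_rough_sets U \<mu>\<^esub>
          (fuzzy_lower U \<mu> B, fuzzy_upper U \<mu> B) \<longleftrightarrow>
        (rough_lower U ?E A, rough_upper U ?E A) \<sqsubseteq>\<^bsub>rough_sets U ?E\<^esub>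
          (rough_lower U ?E B, rough_upper U ?E B)"
      using upper[of A B] lower[of A B]
      by (auto simp: fuzzy_rough_sets_def rough_sets_def)
  qed
  then show ?thesis
    using E complete_lattice_order_isomorphic[OF partial_order_fuzzy_rough_sets
        complete_lattice_rough_sets[OF E]] by blast
qed

end
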